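(* There exist infinite sets $A,B$ of nonnegative integers such that $A+B=\{a+b:a\in A,b\in B\}$ contains every nonnegative integer, \[ \lim_{x\to\infty}\frac{A(x)B(x)}{x}=1, \] and for every nonnegative integer $c$ there are infinitely many positive integers $n$ with $d_{A,B}(n)=c$.
   Context: For a set $S$ of nonnegative integers, $S(x)$ denotes the number of elements of $S$ not exceeding $x$. For nonempty sets $A,B$ of nonnegative integers and an integer $n$, $d_{A,B}(n)$ denotes the number of pairs $(a,b)\in A\times B$ with $a-b=n$. *)

theory Defs
  imports Complex_Main "HOL-Library.Set_Algebras" "HOL-Library.Extended_Nat"
begin

definition counting :: "nat set \<Rightarrow> real \<Rightarrow> nat"
  where "counting S x = card {s \<in> S. real s \<le> x}"

(* For infinite A and B the number of representations n = a - b may be infinite.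
   The value is therefore an enat: card alone would return 0 in that case. *)
definition diff_count :: "nat set \<Rightarrow> nat set \<Rightarrow> int \<Rightarrow> enat"
  where "diff_count A B n =
    (let P = {(a, b). a \<in> A \<and> b \<in> B \<and> int a - int b = n}
     in if finite P then enat (card P) else \<infinity>)"

end

theory Submission
  imports Defs "HOL-Library.Discrete_Functions" "HOL-Library.Nat_Bijection"
    "HOL-Number_Theory.Cong" "HOL-Real_Asymp.Real_Asymp"
begin

text \<open>
  The set \<open>A\<close> consists of very sparse \<open>a 0 < a 1 < \<dots>\<close> with \<open>a j\<close> congruent to \<open>j\<close> modulo every
  number up to \<open>j\<^sup>2\<close>. Hence \<open>a 0, \<dots>, a k\<close> represent all residues modulo a number
  \<open>modl k\<close> of size \<open>k - O(sqrt k)\<close>, so for \<open>A + B\<close> to cover \<open>{T k..<T (k + 1)}\<close> it is enough that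
  \<open>B\<close> contains the initial segment of length \<open>a k\<close> of this interval, which is negligible, and one
  residue class modulo \<open>modl k\<close>. As \<open>A\<close> has at most \<open>k + 2\<close> elements up to \<open>T (k + 1)\<close>, this is
  asymptotically optimal.

  The number \<open>a (k + 1)\<close> lies inside the interval, and the residue class is chosen to be that of
  \<open>a (k + 1) - 1\<close>. Since \<open>modl k\<close> is even for large \<open>k\<close>, the even numbers \<open>target k\<close> are so far not
  of the form \<open>a l - b\<close> with \<open>b \<in> B\<close>. Adding \<open>a l - target k\<close> for prescribed values of \<open>l > k\<close>
  to \<open>B\<close> gives \<open>target k\<close> any desired number of representations, and these elements are too
  sparse to affect the density.
\<close>

text \<open>The term \<open>(k + 2)^4 * a k\<close> is \<open>T k\<close> written out, as
  \<open>T\<close> is itself defined from \<open>a\<close>. The factor 8 leaves room between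
  \<open>T k\<close> and \<open>a (Suc k)\<close> for the shifts by targets.\<close>

primrec a :: "nat \<Rightarrow> nat" where
  "a 0 = 0"
| "a (Suc k) = Suc k + fact ((Suc k)^2) * (8 * ((k + 2)^4 * a k + 1))"

declare a.simps(2) [simp del]

text \<open>Of the four powers, one pays for the size of the counting function of
  \<open>range a\<close>, two for the error terms in that of \<open>B\<close>, and one is left over
  to tend to infinity.\<close>

definition T :: "nat \<Rightarrow> nat" where "T k = (k + 2)^4 * a k"

text \<open>Rounding to an even number serves the parity argument for \<open>target\<close>; the
  maximum avoids modulus 0 for small \<open>k\<close>.\<close>

definition modl :: "nat \<Rightarrow> nat" where "modl k = max 1 (2 * ((k - floor_sqrt k) div 2))"

definition target :: "nat \<Rightarrow> nat" where "target k = 2 * (a k + 1)"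

text \<open>Reading the index as a pair makes every value occur for infinitely many
  \<open>k\<close>.\<close>

definition reps :: "nat \<Rightarrow> nat" where "reps k = snd (prod_decode k)"

definition extra :: "nat set" where
  "extra = {a l - target k | k l. k < l \<and> l \<le> k + reps k}"

definition B :: "nat set" where
  "B = {b. \<exists>k. T k \<le> b \<and> b < T (Suc k) \<and>
            (b \<le> T k + a k \<or> [b + 1 = a (Suc k)] (mod modl k))} \<union> extra"

section \<open>Growth of \<open>a\<close> and the division of the naturals into stages\<close>

lemma a_Suc_gt: "8 * T k + k + 8 < a (Suc k)"
proof -
  have "8 * T k + 8 \<le> fact ((Suc k)^2) * (8 * T k + 8)"
    using mult_le_mono1[OF fact_ge_1, of "8 * T k + 8" "(Suc k)^2"] by simp
  moreover have "a (Suc k) = Suc k + fact ((Suc k)^2) * (8 * T k + 8)"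
    by (simp only: a.simps(2) T_def distrib_left mult_1_right)
  ultimately show ?thesis by linarith
qed

lemma a_le_T: "a k \<le> T k"
  by (simp add: T_def)

lemma strict_mono_a: "strict_mono a"
  unfolding strict_mono_Suc_iff
proof
  fix k show "a k < a (Suc k)" using a_Suc_gt[of k] a_le_T[of k] by linarith
qed

lemma strict_mono_T: "strict_mono T"
  unfolding strict_mono_Suc_iff
proof
  fix k show "T k < T (Suc k)" using a_Suc_gt[of k] a_le_T[of "Suc k"] by linarith
qed

lemma ex_stage: "\<exists>k. T k \<le> n \<and> n < T (Suc k)"
proof -
  have "n < T (Suc n)"
    using strict_mono_imp_increasing[OF strict_mono_T, of "Suc n"] by linarith
  then have ex: "\<exists>k. n < T k" by blast
  define j where "j = (LEAST k. n < T k)"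
  have j: "n < T j" using LeastI_ex[OF ex] by (simp add: j_def)
  moreover have "T 0 = 0" by (simp add: T_def)
  ultimately obtain k where k: "j = Suc k" by (cases j) auto
  have "\<not> n < T k" using not_less_Least[of k "\<lambda>k. n < T k"] k j_def by auto
  with j k have "T k \<le> n \<and> n < T (Suc k)" by simp
  then show ?thesis ..
qed

lemma stage_unique:
  assumes "T p \<le> n" "n < T (Suc p)" "T q \<le> n" "n < T (Suc q)"
  shows "p = q"
proof -
  have "T p < T (Suc q)" "T q < T (Suc p)" using assms by linarith+
  then show ?thesis using strict_mono_less[OF strict_mono_T] by (metis less_antisym not_less_eq)
qed

section \<open>The moduli and the residues of \<open>a\<close>\<close>

lemma modl_pos: "modl k > 0"
  by (simp add: modl_def)

lemma modl_le: "modl k \<le> Suc k"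
  by (auto simp: modl_def)

text \<open>From 3 on, \<open>k - floor_sqrt k\<close> is at least 2, so the even branch of the
  maximum is taken.\<close>

lemma even_modl: "3 \<le> k \<Longrightarrow> even (modl k)"
proof -
  assume k: "3 \<le> k"
  have "(floor_sqrt k)^2 \<le> k" by simp
  have "floor_sqrt k + 2 \<le> k"
  proof (rule ccontr)
    assume "\<not> floor_sqrt k + 2 \<le> k"
    then have "k - 1 \<le> floor_sqrt k" by simp
    then have "(k - 1)^2 \<le> k" using \<open>(floor_sqrt k)^2 \<le> k\<close> power_mono le_trans by blast
    moreover obtain j where "k = j + 3" using k by (metis add.commute le_Suc_ex)
    ultimately show False by (simp add: power2_eq_square)
  qed
  then have "1 \<le> (k - floor_sqrt k) div 2" by simp
  then have "modl k = 2 * ((k - floor_sqrt k) div 2)" by (simp add: modl_def)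
  then show ?thesis by simp
qed

text \<open>The integer square root rises by at most one per step, so
  \<open>k - floor_sqrt k\<close> never falls.\<close>

lemma modl_mono: "modl k \<le> modl (Suc k)"
proof -
  have "floor_sqrt (Suc k) \<le> Suc (floor_sqrt k)"
  proof (rule ccontr)
    assume "\<not> floor_sqrt (Suc k) \<le> Suc (floor_sqrt k)"
    then have "(floor_sqrt k + 2)^2 \<le> (floor_sqrt (Suc k))^2" by (intro power_mono) auto
    also have "\<dots> \<le> Suc k" by simp
    finally have "(floor_sqrt k + 2)^2 \<le> Suc k" .
    moreover have "k < (Suc (floor_sqrt k))^2" by (rule Suc_floor_sqrt_power2_gt)
    ultimately show False by (simp add: power2_eq_square)
  qed
  then have "k - floor_sqrt k \<le> Suc k - floor_sqrt (Suc k)" by simp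
  then have "(k - floor_sqrt k) div 2 \<le> (Suc k - floor_sqrt (Suc k)) div 2" by (rule div_le_mono)
  then show ?thesis unfolding modl_def by (intro max.mono) auto
qed

lemma modl_ge: "real k - sqrt (real k) - 1 \<le> real (modl k)"
proof -
  have "real ((floor_sqrt k)^2) \<le> real k" by (simp del: of_nat_power)
  then have "real (floor_sqrt k) \<le> sqrt (real k)" by (simp add: real_le_rsqrt)
  moreover have "k - floor_sqrt k \<le> modl k + 1" unfolding modl_def by (simp add: max_def) linarith
  ultimately show ?thesis by linarith
qed

text \<open>Unless the modulus is 1, the last \<open>modl k\<close> indices up to \<open>k\<close>
  all exceed \<open>floor_sqrt k\<close>. Then \<open>modl k \<le> k < j^2\<close>, so the modulus
  divides the factorial in \<open>a j\<close>.\<close>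

lemma a_cong:
  assumes "Suc k - modl k \<le> j" "j \<le> k"
  shows "[a j = j] (mod modl k)"
proof (cases "modl k = 1")
  case True
  then show ?thesis by simp
next
  case False
  then have m: "modl k = 2 * ((k - floor_sqrt k) div 2)" by (auto simp: modl_def max_def split: if_splits)
  then have "modl k \<le> k - floor_sqrt k" by simp
  moreover from this have "floor_sqrt k \<le> k" "0 < k" using modl_pos[of k] by linarith+
  ultimately have j: "Suc (floor_sqrt k) \<le> j" using assms by linarith
  have "modl k \<le> k" using \<open>modl k \<le> k - floor_sqrt k\<close> by simp
  also have "k < (Suc (floor_sqrt k))^2" by (rule Suc_floor_sqrt_power2_gt)
  also have "\<dots> \<le> j^2" using j by (intro power_mono) auto
  finally have "modl k dvd fact (j^2)" using modl_pos[of k] by (intro dvd_fact) auto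
  moreover obtain i where i: "j = Suc i" using j by (cases j) auto
  ultimately have "modl k dvd a j - j" "j \<le> a j" by (auto simp: a.simps(2) simp del: fact_Suc power_Suc)
  then show ?thesis by (metis cong_altdef_nat)
qed

section \<open>Covering all naturals by sums\<close>

lemma ex_cong_interval:
  fixes m k :: nat and r :: int
  assumes "0 < m" "m \<le> Suc k"
  shows "\<exists>j. Suc k - m \<le> j \<and> j \<le> k \<and> [int j = r] (mod int m)"
proof -
  define s where "s = (int k - r) mod int m"
  have s: "0 \<le> s" "s < int m" using assms by (auto simp: s_def)
  have "[s = int k - r] (mod int m)" by (simp add: s_def)
  from cong_diff[OF cong_refl[of "int k"] this] have "[int k - s = r] (mod int m)" by simp
  moreover have "int k - s = int (nat (int k - s))" using s assms by simp
  ultimately show ?thesis using s assms by (intro exI[of _ "nat (int k - s)"]) auto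
qed

lemma zero_in_A: "0 \<in> range a"
  by (metis a.simps(1) rangeI)

lemma sumset_UNIV: "range a + B = UNIV"
proof -
  have "n \<in> range a + B" for n
  proof -
    obtain k where k: "T k \<le> n" "n < T (Suc k)" using ex_stage by blast
    show ?thesis
    proof (cases "n \<le> T k + a k")
      case True
      then have "n \<in> B" using k by (auto simp: B_def)
      then show ?thesis using zero_in_A set_plus_intro[of 0 "range a" n B] by simp
    next
      case False
      \<comment> \<open>This \<open>j\<close> puts \<open>n - a j\<close> into the class of
        \<open>a (Suc k) - 1\<close>. As \<open>n\<close> lies beyond the initial segment of length
        \<open>a k\<close>, subtracting \<open>a j\<close> does not leave the stage.\<close>
      obtain j where j: "Suc k - modl k \<le> j" "j \<le> k"
        and c: "[int j = int n + 1 - int (a (Suc k))] (mod int (modl k))"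
        using ex_cong_interval[OF modl_pos modl_le] by blast
      have aj: "a j \<le> a k" using j strict_mono_a by (simp add: strict_mono_less_eq)
      have "[int (a j) = int j] (mod int (modl k))" using a_cong[OF j] by (simp add: cong_int_iff)
      then have "[int (a j) = int n + 1 - int (a (Suc k))] (mod int (modl k))"
        using c by (rule cong_trans)
      then have "[int n + 1 - int (a j) = int n + 1 - (int n + 1 - int (a (Suc k)))] (mod int (modl k))"
        by (intro cong_diff) auto
      moreover have "int n + 1 - int (a j) = int (n - a j + 1)" using False aj by simp
      moreover have "int n + 1 - (int n + 1 - int (a (Suc k))) = int (a (Suc k))" by simp
      ultimately have "[n - a j + 1 = a (Suc k)] (mod modl k)" by (simp only: cong_int_iff)
      moreover have "T k \<le> n - a j" "n - a j < T (Suc k)" using False aj k by linarith+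
      ultimately have "n - a j \<in> B" by (auto simp: B_def)
      then have "a j + (n - a j) \<in> range a + B" by blast
      then show ?thesis using False aj by simp
    qed
  qed
  then show ?thesis by blast
qed

section \<open>Prescribed numbers of representations as differences\<close>

lemma shifted_in_stage:
  assumes "k < l"
  obtains p where "l = Suc p" "k \<le> p" "T p + a p < a l - target k" "a l - target k < T l"
    "a l = a l - target k + target k"
proof -
  obtain p where p: "l = Suc p" using assms by (cases l) auto
  then have "a k \<le> a p" using assms strict_mono_a by (simp add: strict_mono_less_eq)
  \<comment> \<open>Since \<open>a k\<close> and \<open>a p\<close> are at most \<open>T p\<close>,
    this exceeds \<open>T p + a p + target k\<close>: the shift passes the initial segment of stage
    \<open>p\<close>, and the truncated subtraction is exact.\<close>
  moreover have "8 * T p + p + 8 < a l" using a_Suc_gt p by simp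
  moreover have "a p \<le> T p" "a l \<le> T l" by (rule a_le_T)+
  moreover have "k \<le> p" using assms p by simp
  moreover have "target k = 2 * (a k + 1)" by (rule target_def)
  ultimately show ?thesis using that p by fastforce
qed

text \<open>The stage containing the shifted element determines \<open>l\<close>; the size of the
  shift then determines \<open>k\<close>.\<close>

lemma shifted_eq:
  assumes "k < l" "k' < l'" "a l - target k = a l' - target k'"
  shows "l = l' \<and> k = k'"
proof -
  obtain p where p: "l = Suc p" "T p + a p < a l - target k" "a l - target k < T l"
    "a l = a l - target k + target k" using shifted_in_stage[OF assms(1)] by metis
  obtain q where q: "l' = Suc q" "T q + a q < a l' - target k'" "a l' - target k' < T l'"
    "a l' = a l' - target k' + target k'" using shifted_in_stage[OF assms(2)] by metis
  have "p = q" using stage_unique[of p "a l - target k" q] p q assms(3) by simp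
  then have l: "l = l'" using p q by simp
  then have "target k = target k'" using p(4) q(4) assms(3) unfolding l by linarith
  then have "a k = a k'" by (simp add: target_def)
  then show ?thesis using l strict_mono_a by (simp add: strict_mono_eq)
qed

lemma inj_target: "inj target"
  using strict_mono_a by (auto simp: inj_def target_def strict_mono_eq)

text \<open>Of the three ways into \<open>B\<close>, the initial segment is excluded by position and
  the residue class by parity, while \<open>extra\<close> contains this element only through the
  pair \<open>k\<close>, \<open>l\<close> itself.\<close>

lemma shifted_in_B_iff:
  assumes "3 \<le> k" "k < l"
  shows "a l - target k \<in> B \<longleftrightarrow> l \<le> k + reps k"
proof
  assume "l \<le> k + reps k"
  then show "a l - target k \<in> B" using assms by (auto simp: B_def extra_def)
next
  define b where "b = a l - target k"
  assume "a l - target k \<in> B"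
  then have "b \<in> B" by (simp add: b_def)
  obtain p where p: "l = Suc p" "k \<le> p" "T p + a p < b" "b < T l" "a l = b + target k"
    using shifted_in_stage[OF assms(2)] unfolding b_def by metis
  from \<open>b \<in> B\<close> consider q where "T q \<le> b" "b < T (Suc q)"
      "b \<le> T q + a q \<or> [b + 1 = a (Suc q)] (mod modl q)" | "b \<in> extra"
    by (auto simp: B_def)
  then show "l \<le> k + reps k"
  proof cases
    case 1
    then have "q = p" using stage_unique[of p b q] p by simp
    \<comment> \<open>Here \<open>a (Suc p) = b + target k\<close>; modulo 2 the congruence would
      make \<open>target k\<close> odd.\<close>
    then have "[b + 1 = b + target k] (mod modl p)" using 1 p by auto
    moreover have "2 dvd modl p" using even_modl assms p by auto
    ultimately have "[b + 1 = b + target k] (mod 2)" using cong_dvd_modulus_nat by blast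
    then have "even (b + 1) = even (b + target k)" by (metis cong_dvd_iff)
    then show ?thesis by (simp add: target_def)
  next
    case 2
    then obtain k' l' where "b = a l' - target k'" "k' < l'" "l' \<le> k' + reps k'"
      by (auto simp: extra_def)
    then show ?thesis using shifted_eq[OF assms(2), of k' l'] b_def by auto
  qed
qed

lemma diff_count_target:
  assumes "3 \<le> k"
  shows "diff_count (range a) B (int (target k)) = enat (reps k)"
proof -
  define P where "P = {(x, b). x \<in> range a \<and> b \<in> B \<and> int x - int b = int (target k)}"
  have "P = (\<lambda>l. (a l, a l - target k)) ` {k<..k + reps k}"
  proof (intro set_eqI iffI)
    fix z assume "z \<in> P"
    then obtain l b where z: "z = (a l, b)" "b \<in> B" "int (a l) - int b = int (target k)"
      by (auto simp: P_def)
    then have b: "b = a l - target k" "target k \<le> a l" by linarith+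
    \<comment> \<open>As \<open>target k\<close> exceeds \<open>a k\<close>, no element up to
      \<open>a k\<close> can be the minuend.\<close>
    then have "a k < a l" by (simp add: target_def)
    then have "k < l" using strict_mono_a by (simp add: strict_mono_less)
    then have "l \<le> k + reps k" using shifted_in_B_iff[OF assms] z b by auto
    then show "z \<in> (\<lambda>l. (a l, a l - target k)) ` {k<..k + reps k}" using z b \<open>k < l\<close> by auto
  next
    fix z assume "z \<in> (\<lambda>l. (a l, a l - target k)) ` {k<..k + reps k}"
    then obtain l where l: "z = (a l, a l - target k)" "k < l" "l \<le> k + reps k" by auto
    then have "a l - target k \<in> B" using shifted_in_B_iff[OF assms] by auto
    moreover have "a l = a l - target k + target k" using shifted_in_stage[OF l(2)] by metis
    ultimately show "z \<in> P" using l(1) by (auto simp: P_def)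
  qed
  moreover have "inj_on (\<lambda>l. (a l, a l - target k)) {k<..k + reps k}"
    using strict_mono_a by (auto simp: inj_on_def strict_mono_eq)
  ultimately have "finite P" "card P = reps k" by (auto simp: card_image)
  then show ?thesis by (simp add: diff_count_def P_def Let_def)
qed

lemma infinite_diff_count_eq:
  "infinite {n::int. n > 0 \<and> diff_count (range a) B n = enat c}"
proof -
  \<comment> \<open>The second entry fixes the number of representations; the offset 3 keeps the
    index in the range where the moduli are even.\<close>
  define f where "f i = int (target (prod_encode (i + 3, c)))" for i
  have "inj f" unfolding f_def by (intro injI) (auto dest: injD[OF inj_target] simp: prod_encode_eq)
  then have "infinite (range f)" by (rule range_inj_infinite)
  moreover have "range f \<subseteq> {n. n > 0 \<and> diff_count (range a) B n = enat c}"
  proof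
    fix n assume "n \<in> range f"
    then obtain i where n: "n = int (target (prod_encode (i + 3, c)))" by (auto simp: f_def)
    have "3 \<le> prod_encode (i + 3, c)" using le_prod_encode_1[of "i + 3" c] by linarith
    then show "n \<in> {n. n > 0 \<and> diff_count (range a) B n = enat c}"
      using diff_count_target n by (simp add: reps_def target_def)
  qed
  ultimately show ?thesis using finite_subset by blast
qed

section \<open>Counting functions and the limit\<close>

lemma card_progression_le:
  fixes m r u v :: nat
  assumes "0 < m" "u \<le> v"
  shows "real (card {b \<in> {u..v}. [b + 1 = r] (mod m)}) \<le> (real v - real u) / real m + 1"
proof -
  let ?S = "{b \<in> {u..v}. [b + 1 = r] (mod m)}"
  \<comment> \<open>Members of the class share the remainder of \<open>b - u\<close> modulo
    \<open>m\<close>, so the quotient identifies them.\<close>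
  have "inj_on (\<lambda>b. (b - u) div m) ?S"
  proof (rule inj_onI)
    fix b c assume b: "b \<in> ?S" and c: "c \<in> ?S" and eq: "(b - u) div m = (c - u) div m"
    have "[b + 1 = c + 1] (mod m)" using b c cong_trans cong_sym by blast
    then have "[(b - u) + (u + 1) = (c - u) + (u + 1)] (mod m)" using b c by simp
    then have "[b - u = c - u] (mod m)" by (simp only: cong_add_rcancel_nat)
    then have "(b - u) mod m = (c - u) mod m" unfolding unique_euclidean_semiring_class.cong_def .
    then have "(b - u) div m * m + (b - u) mod m = (c - u) div m * m + (c - u) mod m"
      by (simp only: eq)
    then have "b - u = c - u" by simp
    moreover have "u \<le> b" "u \<le> c" using b c by auto
    ultimately show "b = c" by linarith
  qed
  moreover have "(\<lambda>b. (b - u) div m) ` ?S \<subseteq> {..(v - u) div m}"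
    by (auto intro: div_le_mono)
  ultimately have "card ?S \<le> (v - u) div m + 1"
    using card_inj_on_le[of _ ?S "{..(v - u) div m}"] by simp
  then have "real (card ?S) \<le> real ((v - u) div m) + 1" by linarith
  also have "real ((v - u) div m) \<le> real (v - u) / real m" by (rule of_nat_div_le_of_nat)
  finally show ?thesis using assms by simp
qed

lemma counting_nat: "counting S x = card {s \<in> S. s \<le> nat \<lfloor>x\<rfloor>}" if "0 \<le> x"
  unfolding counting_def using that by (intro arg_cong[of _ _ card]) (auto simp: le_nat_iff le_floor_iff)

lemma card_A_le:
  assumes "n < T (Suc i)"
  shows "card {s \<in> range a. s \<le> n} \<le> i + 2"
proof -
  have "{s \<in> range a. s \<le> n} \<subseteq> a ` {..Suc i}"
  proof clarsimp
    fix l assume "a l \<le> n"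
    \<comment> \<open>The next element \<open>a (Suc (Suc i))\<close> already lies beyond
      \<open>T (Suc i)\<close>.\<close>
    then have "a l < a (Suc (Suc i))" using assms a_Suc_gt[of "Suc i"] by linarith
    then show "a l \<in> a ` {..Suc i}" using strict_mono_a by (simp add: strict_mono_less less_Suc_eq_le)
  qed
  then have "card {s \<in> range a. s \<le> n} \<le> card (a ` {..Suc i})" by (intro card_mono) auto
  also have "\<dots> \<le> card {..Suc i}" by (rule card_image_le) simp
  finally show ?thesis by simp
qed

lemma card_B_le:
  assumes "T (Suc i) \<le> n" "n < T (Suc (Suc i))"
  shows "real (card {b \<in> B. b \<le> n})
      \<le> real n / real (modl i) + 2 * real (T i) + real (a (Suc i)) + 4 + (real i + 3)^2"
proof -
  define S where "S k u v = {b \<in> {u..v}. [b + 1 = a (Suc k)] (mod modl k)}" for k u v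
  define E where "E = (\<lambda>(k, l). a l - target k) ` ({..Suc i} \<times> {..Suc (Suc i)})"
  \<comment> \<open>The first set takes all stages before \<open>i\<close> and the initial segment
    of stage \<open>i\<close>. The progression of stage \<open>i\<close> is extended down to 0 so
    that its length and that of the next one add up to \<open>n\<close>.\<close>
  have sub: "{b \<in> B. b \<le> n} \<subseteq> {..2 * T i} \<union> S i 0 (T (Suc i))
      \<union> {T (Suc i)..T (Suc i) + a (Suc i)} \<union> S (Suc i) (T (Suc i)) n \<union> E" (is "_ \<subseteq> ?R")
  proof
    fix b assume "b \<in> {b \<in> B. b \<le> n}"
    then have b: "b \<in> B" "b \<le> n" by auto
    then consider q where "T q \<le> b" "b < T (Suc q)"
      "b \<le> T q + a q \<or> [b + 1 = a (Suc q)] (mod modl q)" | "b \<in> extra"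
      by (auto simp: B_def)
    then show "b \<in> ?R"
    proof cases
      case 1
      have "T q < T (Suc (Suc i))" using 1 b assms by linarith
      then have "q < Suc (Suc i)" using strict_mono_T by (simp add: strict_mono_less)
      then consider "Suc q \<le> i" | "q = i" | "q = Suc i" by linarith
      then show ?thesis
      proof cases
        case 1
        then have "T (Suc q) \<le> T i" using strict_mono_T by (simp add: strict_mono_less_eq)
        then show ?thesis using \<open>b < T (Suc q)\<close> by simp
      next
        case 2
        then show ?thesis using 1 a_le_T[of i] by (auto simp: S_def)
      next
        case 3
        then show ?thesis using 1 b by (auto simp: S_def)
      qed
    next
      case 2
      then obtain k l where kl: "b = a l - target k" "k < l" by (auto simp: extra_def)
      \<comment> \<open>The position of the shift bounds \<open>l\<close>, leaving only
        quadratically many pairs.\<close>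
      obtain p where "l = Suc p" "T p + a p < b" using shifted_in_stage[OF kl(2)] kl by metis
      then have "T p < T (Suc (Suc i))" using b assms by linarith
      then have "p \<le> Suc i" using strict_mono_T by (simp add: strict_mono_less)
      then have "(k, l) \<in> {..Suc i} \<times> {..Suc (Suc i)}" using kl \<open>l = Suc p\<close> by simp
      then have "b \<in> E" unfolding E_def kl(1) by (rule rev_image_eqI) simp
      then show ?thesis by blast
    qed
  qed
  have fin: "finite E" "finite (S k u v)" for k u v by (auto simp: E_def S_def)
  have "card E \<le> card ({..Suc i} \<times> {..Suc (Suc i)})" unfolding E_def by (rule card_image_le) simp
  also have "\<dots> = (i + 2) * (i + 3)" by (simp add: card_cartesian_product algebra_simps)
  finally have "card E \<le> (i + 2) * (i + 3)" .
  then have "real (card E) \<le> real ((i + 2) * (i + 3))" by (rule of_nat_mono)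
  then have E: "real (card E) \<le> (real i + 3)^2 - 3" by (simp add: power2_eq_square algebra_simps)
  have Un5: "card (U \<union> V \<union> W \<union> X \<union> Y) \<le> card U + card V + card W + card X + card Y"
    for U V W X Y :: "nat set"
    using card_Un_le[of U V] card_Un_le[of "U \<union> V" W] card_Un_le[of "U \<union> V \<union> W" X]
      card_Un_le[of "U \<union> V \<union> W \<union> X" Y] by linarith
  have "card {b \<in> B. b \<le> n} \<le> card ?R" using sub fin by (intro card_mono) auto
  also have "\<dots> \<le> (2 * T i + 1) + card (S i 0 (T (Suc i))) + (a (Suc i) + 1)
      + card (S (Suc i) (T (Suc i)) n) + card E"
    using Un5[of "{..2 * T i}" "S i 0 (T (Suc i))" "{T (Suc i)..T (Suc i) + a (Suc i)}"
      "S (Suc i) (T (Suc i)) n" E] by simp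
  finally have "real (card {b \<in> B. b \<le> n}) \<le> (2 * real (T i) + 1) + real (card (S i 0 (T (Suc i))))
      + (real (a (Suc i)) + 1) + real (card (S (Suc i) (T (Suc i)) n)) + real (card E)"
    by linarith
  moreover have "real (card (S i 0 (T (Suc i)))) \<le> real (T (Suc i)) / real (modl i) + 1"
    using card_progression_le[OF modl_pos, of 0] by (simp add: S_def)
  moreover have "real (card (S (Suc i) (T (Suc i)) n))
      \<le> (real n - real (T (Suc i))) / real (modl (Suc i)) + 1"
    using card_progression_le[OF modl_pos assms(1)] by (simp add: S_def)
  \<comment> \<open>Passing to the smaller modulus \<open>modl i\<close> lets the two main terms
    combine into \<open>n / modl i\<close>.\<close>
  moreover have "(real n - real (T (Suc i))) / real (modl (Suc i))
      \<le> (real n - real (T (Suc i))) / real (modl i)"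
    using assms(1) modl_mono[of i] modl_pos[of i] by (intro divide_left_mono) auto
  moreover have "real (T (Suc i)) / real (modl i) + (real n - real (T (Suc i))) / real (modl i)
      = real n / real (modl i)"
    by (simp add: diff_divide_distrib)
  ultimately show ?thesis using E by linarith
qed

lemma product_le:
  assumes "real (T (Suc i)) \<le> x" "x < real (T (Suc (Suc i)))"
  shows "real (counting (range a) x) * real (counting B x) / x
    \<le> (real i + 3) / real (modl i) + 2 / (real i + 3)"
proof -
  define n where "n = nat \<lfloor>x\<rfloor>"
  define t where "t = real i + 3"
  define \<alpha> where "\<alpha> = real (a (Suc i))"
  have x0: "0 \<le> x" using assms by linarith
  have a1: "2 * real (T i) + 4 \<le> \<alpha>" "1 \<le> \<alpha>" using a_Suc_gt[of i] by (simp_all add: \<alpha>_def)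
  have Tx: "t^4 * \<alpha> \<le> x"
    using assms by (simp add: T_def t_def \<alpha>_def add.commute)
  have t3: "3 \<le> t" by (simp add: t_def)
  then have "t^4 * \<alpha> > 0" using a1 by simp
  then have x1: "x > 0" using Tx by linarith
  have n: "T (Suc i) \<le> n" "n < T (Suc (Suc i))" "real n \<le> x"
    using assms x0 unfolding n_def by (auto simp: le_nat_iff le_floor_iff nat_less_iff floor_less_iff)
  have "real (counting B x)
      \<le> real n / real (modl i) + 2 * real (T i) + real (a (Suc i)) + 4 + (real i + 3)^2"
    using card_B_le[OF n(1,2)] counting_nat[OF x0, of B] by (simp add: n_def)
  \<comment> \<open>All lower terms are absorbed using \<open>2 * T i + 4 \<le> \<alpha>\<close> and
    \<open>3 \<le> t\<close>.\<close>
  also have "\<dots> \<le> x / real (modl i) + 2 * t^2 * \<alpha>"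
  proof -
    have "real n / real (modl i) \<le> x / real (modl i)" using n by (intro divide_right_mono) auto
    moreover have "t^2 * 1 \<le> t^2 * \<alpha>" using a1 by (intro mult_left_mono) auto
    moreover have "3 * 3 \<le> t * t" using t3 by (intro mult_mono) auto
    then have "2 * \<alpha> \<le> t^2 * \<alpha>" using a1 by (intro mult_right_mono) (auto simp: power2_eq_square)
    ultimately show ?thesis using a1 unfolding t_def[symmetric] \<alpha>_def[symmetric] by linarith
  qed
  finally have B: "real (counting B x) \<le> x / real (modl i) + 2 * t^2 * \<alpha>" .
  have A: "real (counting (range a) x) \<le> t"
    using card_A_le[OF n(2)] counting_nat[OF x0, of "range a"] by (simp add: n_def t_def)
  have "real (counting (range a) x) * real (counting B x) \<le> t * (x / real (modl i) + 2 * t^2 * \<alpha>)"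
    using A B t3 by (intro mult_mono) auto
  then have "real (counting (range a) x) * real (counting B x) / x
      \<le> t * (x / real (modl i) + 2 * t^2 * \<alpha>) / x"
    using x1 by (intro divide_right_mono) auto
  \<comment> \<open>Isolating \<open>t^4 * \<alpha> / x\<close>, which is at most 1 because
    \<open>x\<close> has reached \<open>T (Suc i)\<close>, leaves the error
    \<open>2 / t\<close>.\<close>
  also have "\<dots> = t / real (modl i) + 2 / t * (t^4 * \<alpha> / x)"
    using x1 t3 modl_pos[of i] by (simp add: field_simps power2_eq_square power4_eq_xxxx)
  also have "\<dots> \<le> t / real (modl i) + 2 / t * 1"
    using Tx x1 t3 by (intro add_left_mono mult_left_mono) auto
  finally show ?thesis by (simp add: t_def)
qed

text \<open>Summands of a number up to \<open>x\<close> are themselves at most \<open>x\<close>, so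
  the pairs must cover the floor of \<open>x\<close> plus one values, which is more than
  \<open>x\<close>.\<close>

lemma counting_product_ge:
  assumes "X + Y = (UNIV :: nat set)" "0 \<le> x"
  shows "x \<le> real (counting X x) * real (counting Y x)"
proof -
  define n where "n = nat \<lfloor>x\<rfloor>"
  let ?X = "{s \<in> X. s \<le> n}" and ?Y = "{s \<in> Y. s \<le> n}"
  have "{..n} \<subseteq> (\<lambda>(s, t). s + t) ` (?X \<times> ?Y)"
  proof
    fix y assume "y \<in> {..n}"
    moreover obtain s t where "s \<in> X" "t \<in> Y" "y = s + t" using assms(1) by (metis UNIV_I set_plus_elim)
    ultimately show "y \<in> (\<lambda>(s, t). s + t) ` (?X \<times> ?Y)" by force
  qed
  then have "card {..n} \<le> card (?X \<times> ?Y)"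
    by (intro surj_card_le) auto
  then have "Suc n \<le> counting X x * counting Y x"
    using assms(2) by (simp add: counting_nat n_def card_cartesian_product)
  then have "real (Suc n) \<le> real (counting X x) * real (counting Y x)"
    unfolding of_nat_mult[symmetric] by (rule of_nat_mono)
  moreover have "x < real (Suc n)" using assms(2) unfolding n_def by linarith
  ultimately show ?thesis by linarith
qed

lemma product_limit:
  "((\<lambda>x::real. real (counting (range a) x) * real (counting B x) / x) \<longlongrightarrow> 1) at_top"
proof (rule tendstoI)
  fix e :: real assume e: "0 < e"
  \<comment> \<open>This is the upper bound with \<open>modl i\<close> replaced by its lower
    estimate.\<close>
  have "(\<lambda>i. (real i + 3) / (real i - sqrt (real i) - 1) + 2 / (real i + 3)) \<longlonglongrightarrow> 1"
    by real_asymp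
  then have "eventually (\<lambda>i. (real i + 3) / (real i - sqrt (real i) - 1) + 2 / (real i + 3) < 1 + e) sequentially"
    by (rule order_tendstoD) (use e in simp)
  moreover have "eventually (\<lambda>i. 0 < real i - sqrt (real i) - 1) sequentially"
    by real_asymp
  ultimately have "eventually (\<lambda>i. (real i + 3) / real (modl i) + 2 / (real i + 3) < 1 + e) sequentially"
  proof eventually_elim
    case (elim i)
    have "(real i + 3) / real (modl i) \<le> (real i + 3) / (real i - sqrt (real i) - 1)"
      using elim modl_ge[of i] by (intro divide_left_mono mult_pos_pos) auto
    then show ?case using elim by linarith
  qed
  then obtain I where I: "(real i + 3) / real (modl i) + 2 / (real i + 3) < 1 + e" if "i \<ge> I" for i
    by (auto simp: eventually_sequentially)
  show "eventually (\<lambda>x. dist (real (counting (range a) x) * real (counting B x) / x) 1 < e) at_top"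
    using eventually_ge_at_top[of "real (T (Suc I))"] eventually_gt_at_top[of 0]
  proof eventually_elim
    case (elim x)
    \<comment> \<open>The product bound is indexed by the stage before that of \<open>x\<close>,
      hence \<open>k = Suc i\<close> with \<open>I \<le> i\<close>.\<close>
    obtain k where k: "T k \<le> nat \<lfloor>x\<rfloor>" "nat \<lfloor>x\<rfloor> < T (Suc k)" using ex_stage by blast
    then have kx: "real (T k) \<le> x" "x < real (T (Suc k))" using elim by linarith+
    then have "T (Suc I) < T (Suc k)" using elim by linarith
    then have "I < k" using strict_mono_T by (simp add: strict_mono_less)
    then obtain i where i: "k = Suc i" "I \<le> i" by (cases k) auto
    have "real (counting (range a) x) * real (counting B x) / x < 1 + e"
      using product_le[of i x] I[of i] i kx by fastforce
    moreover have "1 \<le> real (counting (range a) x) * real (counting B x) / x"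
      using counting_product_ge[OF sumset_UNIV, of x] elim by simp
    ultimately show ?case using e by (simp add: dist_real_def)
  qed
qed

lemma infinite_B: "infinite B"
proof -
  \<comment> \<open>Each \<open>T k\<close> starts the initial segment of its own stage.\<close>
  have "range T \<subseteq> B" using strict_mono_T by (auto simp: B_def strict_mono_less)
  moreover have "infinite (range T)" using strict_mono_T by (simp add: range_inj_infinite strict_mono_imp_inj_on)
  ultimately show ?thesis using finite_subset by blast
qed

theorem theorem4:
  shows "\<exists>A B :: nat set. infinite A \<and> infinite B \<and>
    A + B = UNIV \<and>
    ((\<lambda>x::real. real (counting A x) * real (counting B x) / x) \<longlongrightarrow> 1) at_top \<and>
    (\<forall>c::nat. infinite {n::int. n > 0 \<and> diff_count A B n = enat c})"
proof -
  have "infinite (range a)" using strict_mono_a by (simp add: range_inj_infinite strict_mono_imp_inj_on)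
  then show ?thesis
    using infinite_B sumset_UNIV product_limit infinite_diff_count_eq by blast
qed

end
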